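(* Let $\mathcal{G}_{12,\mathrm{forest}}$ be the set of all permutations $\pi$ such that the occurrence graph $G_{12}(\pi)$ is a forest. Then \[ \mathcal{G}_{12,\mathrm{forest}} = \mathrm{Av}(123, 1432, 2143, 3214). \]
   Context: Permutations of all lengths $n\ge0$ are considered. For a permutation $\pi$ of length $n$, $V_{12}(\pi)$ is the set of pairs $\{i,j\}$ with $1\le i<j\le n$ and $\pi(i)<\pi(j)$, and the occurrence graph $G_{12}(\pi)$ is the simple undirected graph with vertex set $V_{12}(\pi)$ in which two vertices are adjacent iff they share exactly one element. A forest is a graph with no cycles (a disjoint union of trees); the graph with no vertices is a forest. A permutation $\pi$ contains a permutation $q$ of length $k$ if there are indices $i_1<\dots<i_k$ with $\pi(i_1)\cdots\pi(i_k)$ order-isomorphic to $q$, and avoids $q$ otherwise; $\mathrm{Av}(M)$ is the set of permutations avoiding every element of $M$. *)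

theory Defs
  imports "HOL-Combinatorics.Multiset_Permutations"
begin

(* A permutation of length n is represented by its one-line notation,
   i.e. a list that is a rearrangement of 1, ..., n. *)
definition perms :: "nat list set" where
  "perms = (\<Union>n. permutations_of_set {1..n})"

(* pval \<pi> i is \<pi>(i); positions are 1-based, so it is meaningful for 1 \<le> i \<le> length \<pi>. *)
definition pval :: "nat list \<Rightarrow> nat \<Rightarrow> nat" where
  "pval \<pi> i = \<pi> ! (i - 1)"

definition contains_pattern :: "nat list \<Rightarrow> nat list \<Rightarrow> bool" where
  "contains_pattern \<pi> q \<longleftrightarrow>
     (\<exists>i :: nat \<Rightarrow> nat.
        i ` {1..length q} \<subseteq> {1..length \<pi>} \<and>
        strict_mono_on {1..length q} i \<and>
        (\<forall>a\<in>{1..length q}. \<forall>b\<in>{1..length q}.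
           pval \<pi> (i a) < pval \<pi> (i b) \<longleftrightarrow> pval q a < pval q b))"

definition Av :: "nat list set \<Rightarrow> nat list set" where
  "Av M = {\<pi> \<in> perms. \<forall>q\<in>M. \<not> contains_pattern \<pi> q}"

(* Simple undirected graph: vertex set and set of two-element edges. *)
type_synonym 'v ugraph = "'v set \<times> 'v set set"

(* The requirement of at least three vertices excludes walking back and forth along one edge.
   The forest predicate of the digraph library does not exclude this for
   symmetric digraphs, so it is not usable here. *)
definition is_cycle :: "'v ugraph \<Rightarrow> 'v list \<Rightarrow> bool" where
  "is_cycle G c \<longleftrightarrow>
     3 \<le> length c \<and> distinct c \<and> set c \<subseteq> fst G \<and>
     (\<forall>k<length c. {c ! k, c ! (Suc k mod length c)} \<in> snd G)"

definition is_forest :: "'v ugraph \<Rightarrow> bool" where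
  "is_forest G \<longleftrightarrow> (\<nexists>c. is_cycle G c)"

definition V12 :: "nat list \<Rightarrow> nat set set" where
  "V12 \<pi> = {{i, j} | i j. 1 \<le> i \<and> i < j \<and> j \<le> length \<pi> \<and> pval \<pi> i < pval \<pi> j}"

(* There are no loops: a vertex u has two elements, so card (u \<inter> u) = 2. *)
definition G12 :: "nat list \<Rightarrow> nat set ugraph" where
  "G12 \<pi> = (V12 \<pi>, {{u, v} | u v. u \<in> V12 \<pi> \<and> v \<in> V12 \<pi> \<and> card (u \<inter> v) = 1})"

definition G12_forest :: "nat list set" where
  "G12_forest = {\<pi> \<in> perms. is_forest (G12 \<pi>)}"

end

theory Submission
  imports Defs
begin

text \<open>
  Let \<open>H\<close> be the graph on the positions of \<open>\<pi>\<close> whose edges are the elements of \<open>V12 \<pi>\<close>; the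
  occurrence graph is its line graph. An occurrence of 123, 1432 or 3214 yields a
  triangle in the line graph, and an occurrence of 2143 yields a 4-cycle.

  Conversely, let \<open>\<pi>\<close> avoid the four patterns. Avoiding 123 makes every position the lower end of all
  its ascents or the upper end of all of them, and avoiding 1432 and 3214 bounds the degrees of \<open>H\<close>
  by 2. Hence every ascent on a cycle of the line graph has one neighbour sharing its lower end and
  one sharing its upper end. Take the leftmost lower end \<open>a\<close> on the cycle, its two ascents
  \<open>(a, b)\<close>, \<open>(a, d)\<close> with \<open>b < d\<close>, and a further ascent \<open>(a', b)\<close> on the cycle: then
  \<open>a < a' < b < d\<close> is an occurrence of 2143.
\<close>

section \<open>Pattern containment as inequalities between values\<close>

lemma atLeastAtMost_Suc_0_3: "{Suc 0..Suc (Suc (Suc 0))} = {1, 2, 3}"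
  by auto

lemma atLeastAtMost_Suc_0_4: "{Suc 0..Suc (Suc (Suc (Suc 0)))} = {1, 2, 3, 4}"
  by auto

lemma strict_mono_on_iff:
  "strict_mono_on A f \<longleftrightarrow> (\<forall>r\<in>A. \<forall>s\<in>A. r < s \<longrightarrow> f r < f s)"
  by (auto simp: strict_mono_on_def)

text \<open>Pairing each position with its pattern entry lets the simplifier expand the bounded
  quantifiers into finitely many comparisons once the entries are numerals.\<close>

lemma contains_pattern_length3_iff:
  "contains_pattern \<pi> [x, y, z] \<longleftrightarrow>
    (\<exists>a b c. 1 \<le> a \<and> a < b \<and> b < c \<and> c \<le> length \<pi> \<and>
      (\<forall>(i, u) \<in> {(a, x), (b, y), (c, z)}. \<forall>(j, v) \<in> {(a, x), (b, y), (c, z)}.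
        pval \<pi> i < pval \<pi> j \<longleftrightarrow> u < v))" (is "_ \<longleftrightarrow> ?R")
proof
  assume "contains_pattern \<pi> [x, y, z]"
  then obtain i :: "nat \<Rightarrow> nat" where "i ` {1, 2, 3} \<subseteq> {1..length \<pi>}" "strict_mono_on {1, 2, 3} i"
    "\<forall>a\<in>{1, 2, 3}. \<forall>b\<in>{1, 2, 3}.
      pval \<pi> (i a) < pval \<pi> (i b) \<longleftrightarrow> pval [x, y, z] a < pval [x, y, z] b"
    unfolding contains_pattern_def One_nat_def list.size add_0 add_Suc_right add_0_right
      atLeastAtMost_Suc_0_3 by blast
  then show ?R
    by (intro exI[of _ "i 1"] exI[of _ "i 2"] exI[of _ "i 3"])
      (simp add: strict_mono_on_iff pval_def)
next
  assume ?R
  then obtain a b c where "1 \<le> a" "a < b" "b < c" "c \<le> length \<pi>"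
      "\<forall>(i, u) \<in> {(a, x), (b, y), (c, z)}. \<forall>(j, v) \<in> {(a, x), (b, y), (c, z)}.
        pval \<pi> i < pval \<pi> j \<longleftrightarrow> u < v"
    by blast
  then show "contains_pattern \<pi> [x, y, z]"
    unfolding contains_pattern_def
    \<comment> \<open>Pattern positions start at 1, list indices at 0; hence
      \<open>k - 1\<close>.\<close>
    by (intro exI[of _ "\<lambda>k. [a, b, c] ! (k - 1)"])
      (simp add: atLeastAtMost_Suc_0_3 strict_mono_on_iff pval_def)
qed

lemma contains_pattern_length4_iff:
  "contains_pattern \<pi> [x, y, z, w] \<longleftrightarrow>
    (\<exists>a b c d. 1 \<le> a \<and> a < b \<and> b < c \<and> c < d \<and> d \<le> length \<pi> \<and>
      (\<forall>(i, u) \<in> {(a, x), (b, y), (c, z), (d, w)}. \<forall>(j, v) \<in> {(a, x), (b, y), (c, z), (d, w)}.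
        pval \<pi> i < pval \<pi> j \<longleftrightarrow> u < v))" (is "_ \<longleftrightarrow> ?R")
proof
  assume "contains_pattern \<pi> [x, y, z, w]"
  then obtain i :: "nat \<Rightarrow> nat" where "i ` {1, 2, 3, 4} \<subseteq> {1..length \<pi>}"
    "strict_mono_on {1, 2, 3, 4} i"
    "\<forall>a\<in>{1, 2, 3, 4}. \<forall>b\<in>{1, 2, 3, 4}.
      pval \<pi> (i a) < pval \<pi> (i b) \<longleftrightarrow> pval [x, y, z, w] a < pval [x, y, z, w] b"
    unfolding contains_pattern_def One_nat_def list.size add_0 add_Suc_right add_0_right
      atLeastAtMost_Suc_0_4 by blast
  then show ?R
    by (intro exI[of _ "i 1"] exI[of _ "i 2"] exI[of _ "i 3"] exI[of _ "i 4"])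
      (simp add: strict_mono_on_iff pval_def)
next
  assume ?R
  then obtain a b c d where "1 \<le> a" "a < b" "b < c" "c < d" "d \<le> length \<pi>"
      "\<forall>(i, u) \<in> {(a, x), (b, y), (c, z), (d, w)}. \<forall>(j, v) \<in> {(a, x), (b, y), (c, z), (d, w)}.
        pval \<pi> i < pval \<pi> j \<longleftrightarrow> u < v"
    by blast
  then show "contains_pattern \<pi> [x, y, z, w]"
    unfolding contains_pattern_def
    by (intro exI[of _ "\<lambda>k. [a, b, c, d] ! (k - 1)"])
      (simp add: atLeastAtMost_Suc_0_4 strict_mono_on_iff pval_def)
qed

text \<open>The comparisons left out, including the negated ones, follow from the chain by
  transitivity and asymmetry. The same holds for the three patterns below.\<close>

lemma contains_123_iff:
  "contains_pattern \<pi> [1, 2, 3] \<longleftrightarrow>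
    (\<exists>a b c. 1 \<le> a \<and> a < b \<and> b < c \<and> c \<le> length \<pi> \<and>
      pval \<pi> a < pval \<pi> b \<and> pval \<pi> b < pval \<pi> c)"
  unfolding contains_pattern_length3_iff by (intro ex_cong1 iffI) simp_all

lemma contains_1432_iff:
  "contains_pattern \<pi> [1, 4, 3, 2] \<longleftrightarrow>
    (\<exists>a b c d. 1 \<le> a \<and> a < b \<and> b < c \<and> c < d \<and> d \<le> length \<pi> \<and>
      pval \<pi> a < pval \<pi> d \<and> pval \<pi> d < pval \<pi> c \<and> pval \<pi> c < pval \<pi> b)"
  unfolding contains_pattern_length4_iff by (intro ex_cong1 iffI) simp_all

lemma contains_2143_iff:
  "contains_pattern \<pi> [2, 1, 4, 3] \<longleftrightarrow>
    (\<exists>a b c d. 1 \<le> a \<and> a < b \<and> b < c \<and> c < d \<and> d \<le> length \<pi> \<and>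
      pval \<pi> b < pval \<pi> a \<and> pval \<pi> a < pval \<pi> d \<and> pval \<pi> d < pval \<pi> c)"
  unfolding contains_pattern_length4_iff by (intro ex_cong1 iffI) simp_all

lemma contains_3214_iff:
  "contains_pattern \<pi> [3, 2, 1, 4] \<longleftrightarrow>
    (\<exists>a b c d. 1 \<le> a \<and> a < b \<and> b < c \<and> c < d \<and> d \<le> length \<pi> \<and>
      pval \<pi> c < pval \<pi> b \<and> pval \<pi> b < pval \<pi> a \<and> pval \<pi> a < pval \<pi> d)"
  unfolding contains_pattern_length4_iff by (intro ex_cong1 iffI) simp_all

lemma pval_eq_iff:
  assumes "\<pi> \<in> perms" "i \<in> {1..length \<pi>}" "j \<in> {1..length \<pi>}"
  shows "pval \<pi> i = pval \<pi> j \<longleftrightarrow> i = j"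
proof -
  have "distinct \<pi>"
    using assms(1) by (auto simp: perms_def dest: permutations_of_setD)
  then show ?thesis
    using assms(2,3) by (auto simp: pval_def nth_eq_iff_index_eq)
qed

section \<open>Cycles forced by the patterns\<close>

lemma fst_G12 [simp]: "fst (G12 \<pi>) = V12 \<pi>"
  by (simp add: G12_def)

lemma edge_G12_iff: "{u, v} \<in> snd (G12 \<pi>) \<longleftrightarrow> u \<in> V12 \<pi> \<and> v \<in> V12 \<pi> \<and> card (u \<inter> v) = 1"
  by (auto simp: G12_def doubleton_eq_iff Int_commute)

lemma pair_in_V12I:
  "1 \<le> i \<Longrightarrow> i < j \<Longrightarrow> j \<le> length \<pi> \<Longrightarrow> pval \<pi> i < pval \<pi> j \<Longrightarrow> {i, j} \<in> V12 \<pi>"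
  unfolding V12_def by blast

lemma not_forest_if_triangle:
  assumes "{u, v, w} \<subseteq> V12 \<pi>" "distinct [u, v, w]"
    and "card (u \<inter> v) = 1" "card (v \<inter> w) = 1" "card (w \<inter> u) = 1"
  shows "\<not> is_forest (G12 \<pi>)"
proof -
  have "is_cycle (G12 \<pi>) [u, v, w]"
    using assms unfolding is_cycle_def by (auto simp: edge_G12_iff less_Suc_eq)
  then show ?thesis
    by (auto simp: is_forest_def)
qed

lemma not_forest_if_square:
  assumes "{u, v, w, x} \<subseteq> V12 \<pi>" "distinct [u, v, w, x]"
    and "card (u \<inter> v) = 1" "card (v \<inter> w) = 1" "card (w \<inter> x) = 1" "card (x \<inter> u) = 1"
  shows "\<not> is_forest (G12 \<pi>)"
proof -
  have "is_cycle (G12 \<pi>) [u, v, w, x]"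
    using assms unfolding is_cycle_def by (auto simp: edge_G12_iff less_Suc_eq)
  then show ?thesis
    by (auto simp: is_forest_def)
qed

lemma forest_avoids_123:
  assumes "is_forest (G12 \<pi>)"
  shows "\<not> contains_pattern \<pi> [1, 2, 3]"
proof
  assume "contains_pattern \<pi> [1, 2, 3]"
  then obtain a b c where "1 \<le> a" "a < b" "b < c" "c \<le> length \<pi>"
    "pval \<pi> a < pval \<pi> b" "pval \<pi> b < pval \<pi> c"
    unfolding contains_123_iff by blast
  then have "\<not> is_forest (G12 \<pi>)"
    \<comment> \<open>All three pairs of positions are ascents, and any two of them share one
      position.\<close>
    by (intro not_forest_if_triangle[of "{a, b}" "{b, c}" "{a, c}"])
      (auto intro!: pair_in_V12I simp: doubleton_eq_iff Int_insert_left)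
  with assms show False by simp
qed

lemma forest_avoids_1432:
  assumes "is_forest (G12 \<pi>)"
  shows "\<not> contains_pattern \<pi> [1, 4, 3, 2]"
proof
  assume "contains_pattern \<pi> [1, 4, 3, 2]"
  then obtain a b c d where "1 \<le> a" "a < b" "b < c" "c < d" "d \<le> length \<pi>"
    "pval \<pi> a < pval \<pi> d" "pval \<pi> d < pval \<pi> c" "pval \<pi> c < pval \<pi> b"
    unfolding contains_1432_iff by blast
  then have "\<not> is_forest (G12 \<pi>)"
    \<comment> \<open>Three ascents with the common lower end \<open>a\<close> are pairwise
      adjacent.\<close>
    by (intro not_forest_if_triangle[of "{a, b}" "{a, c}" "{a, d}"])
      (auto intro!: pair_in_V12I simp: doubleton_eq_iff Int_insert_left)
  with assms show False by simp
qed

lemma forest_avoids_3214: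
  assumes "is_forest (G12 \<pi>)"
  shows "\<not> contains_pattern \<pi> [3, 2, 1, 4]"
proof
  assume "contains_pattern \<pi> [3, 2, 1, 4]"
  then obtain a b c d where "1 \<le> a" "a < b" "b < c" "c < d" "d \<le> length \<pi>"
    "pval \<pi> c < pval \<pi> b" "pval \<pi> b < pval \<pi> a" "pval \<pi> a < pval \<pi> d"
    unfolding contains_3214_iff by blast
  then have "\<not> is_forest (G12 \<pi>)"
    \<comment> \<open>Dually, the three ascents share the upper end \<open>d\<close>.\<close>
    by (intro not_forest_if_triangle[of "{a, d}" "{b, d}" "{c, d}"])
      (auto intro!: pair_in_V12I simp: doubleton_eq_iff Int_insert_left)
  with assms show False by simp
qed

lemma forest_avoids_2143:
  assumes "is_forest (G12 \<pi>)"
  shows "\<not> contains_pattern \<pi> [2, 1, 4, 3]"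
proof
  assume "contains_pattern \<pi> [2, 1, 4, 3]"
  then obtain a b c d where "1 \<le> a" "a < b" "b < c" "c < d" "d \<le> length \<pi>"
    "pval \<pi> b < pval \<pi> a" "pval \<pi> a < pval \<pi> d" "pval \<pi> d < pval \<pi> c"
    unfolding contains_2143_iff by blast
  then have "\<not> is_forest (G12 \<pi>)"
    \<comment> \<open>Each of \<open>a\<close>, \<open>b\<close> lies below each of
      \<open>c\<close>, \<open>d\<close>. In the order given, consecutive ascents share
      \<open>c\<close>, \<open>b\<close>, \<open>d\<close>, \<open>a\<close> in turn.\<close>
    by (intro not_forest_if_square[of "{a, c}" "{b, c}" "{b, d}" "{a, d}"])
      (auto intro!: pair_in_V12I simp: doubleton_eq_iff Int_insert_left)
  with assms show False by simp
qed

section \<open>Neighbours along a cycle\<close>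

lemma is_cycle_two_neighbours:
  assumes "is_cycle G c" "u \<in> set c"
  obtains v w where "v \<in> set c" "w \<in> set c" "v \<noteq> w" "u \<noteq> v" "u \<noteq> w" "{u, v} \<in> snd G" "{u, w} \<in> snd G"
proof -
  let ?n = "length c"
  have n: "3 \<le> ?n" and "distinct c"
    and edge: "\<And>k. k < ?n \<Longrightarrow> {c ! k, c ! (Suc k mod ?n)} \<in> snd G"
    using assms(1) by (auto simp: is_cycle_def)
  obtain k where k: "k < ?n" "u = c ! k"
    using assms(2) by (auto simp: in_set_conv_nth)
  \<comment> \<open>The neighbours are the cyclic successor \<open>s\<close> and predecessor
    \<open>p\<close> of index \<open>k\<close>; a length of at least 3 keeps these three indices
    distinct.\<close>
  define s where "s = Suc k mod ?n"
  define p where "p = (if k = 0 then ?n - 1 else k - 1)"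
  have s: "s = (if Suc k = ?n then 0 else Suc k)"
    using k by (auto simp: s_def)
  have "Suc p mod ?n = k"
    using k n by (auto simp: p_def)
  moreover have lt: "s < ?n" "p < ?n"
    using k n by (auto simp: s p_def)
  ultimately have "{u, c ! p} \<in> snd G"
    using edge[of p] k by (simp add: insert_commute)
  moreover have "{u, c ! s} \<in> snd G"
    using edge[of k] k by (simp add: s_def)
  moreover have "s \<noteq> p" "s \<noteq> k" "p \<noteq> k"
    using k n by (auto simp: s p_def split: if_splits)
  ultimately show thesis
    using that[of "c ! s" "c ! p"] lt k \<open>distinct c\<close> by (auto simp: nth_eq_iff_index_eq)
qed

section \<open>Permutations avoiding the four patterns\<close>

locale avoiding_perm =
  fixes \<pi> :: "nat list"
  assumes perm: "\<pi> \<in> perms"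
    and avoids_123: "\<not> contains_pattern \<pi> [1, 2, 3]"
    and avoids_1432: "\<not> contains_pattern \<pi> [1, 4, 3, 2]"
    and avoids_2143: "\<not> contains_pattern \<pi> [2, 1, 4, 3]"
    and avoids_3214: "\<not> contains_pattern \<pi> [3, 2, 1, 4]"
begin

definition ascent :: "nat \<Rightarrow> nat \<Rightarrow> bool" where
  "ascent i j \<longleftrightarrow> 1 \<le> i \<and> i < j \<and> j \<le> length \<pi> \<and> pval \<pi> i < pval \<pi> j"

lemma V12_ascent: "u \<in> V12 \<pi> \<longleftrightarrow> (\<exists>i j. u = {i, j} \<and> ascent i j)"
  by (simp add: V12_def ascent_def)

lemma ascent_no_chain: "ascent i j \<Longrightarrow> \<not> ascent j k"
  using avoids_123 unfolding contains_123_iff ascent_def by auto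

text \<open>Otherwise \<open>b\<close>, \<open>d\<close> would itself be an ascent, since values at
  distinct positions differ, and \<open>a\<close>, \<open>b\<close>, \<open>d\<close> would be a
  chain.\<close>

lemma tops_decreasing:
  assumes "ascent a b" "ascent a d" "b < d"
  shows "pval \<pi> d < pval \<pi> b"
  using assms ascent_no_chain[of a b d] pval_eq_iff[OF perm, of b d]
  by (auto simp: ascent_def)

lemma bottoms_decreasing:
  assumes "ascent a d" "ascent b d" "a < b"
  shows "pval \<pi> b < pval \<pi> a"
  using assms ascent_no_chain[of a b d] pval_eq_iff[OF perm, of a b]
  by (cases "pval \<pi> a < pval \<pi> b") (auto simp: ascent_def)

lemma no_three_tops_sorted:
  assumes "ascent a b" "ascent a c" "ascent a d" "b < c" "c < d"
  shows False
proof -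
  have "pval \<pi> c < pval \<pi> b" "pval \<pi> d < pval \<pi> c"
    using assms tops_decreasing by blast+
  with assms have "contains_pattern \<pi> [1, 4, 3, 2]"
    unfolding contains_1432_iff ascent_def by blast
  with avoids_1432 show False ..
qed

lemma no_three_bottoms_sorted:
  assumes "ascent a d" "ascent b d" "ascent c d" "a < b" "b < c"
  shows False
proof -
  have "pval \<pi> b < pval \<pi> a" "pval \<pi> c < pval \<pi> b"
    using assms bottoms_decreasing by blast+
  with assms have "contains_pattern \<pi> [3, 2, 1, 4]"
    unfolding contains_3214_iff ascent_def by blast
  with avoids_3214 show False ..
qed

lemma no_three_tops: "ascent a b \<Longrightarrow> ascent a c \<Longrightarrow> ascent a d \<Longrightarrow> b = c \<or> b = d \<or> c = d"
  by (metis linorder_neqE_nat no_three_tops_sorted)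

lemma no_three_bottoms: "ascent a d \<Longrightarrow> ascent b d \<Longrightarrow> ascent c d \<Longrightarrow> a = b \<or> a = c \<or> b = c"
  by (metis linorder_neqE_nat no_three_bottoms_sorted)

lemma neighbour_cases:
  assumes "ascent a b" "{{a, b}, v} \<in> snd (G12 \<pi>)"
  obtains d where "v = {a, d}" "ascent a d" | e where "v = {e, b}" "ascent e b"
proof -
  obtain e d where v: "v = {e, d}" "ascent e d" and "card ({a, b} \<inter> {e, d}) = 1"
    using assms(2) by (auto simp: edge_G12_iff V12_ascent)
  then have "{a, b} \<inter> {e, d} \<noteq> {}"
    by auto
  \<comment> \<open>A shared position that is the upper end of one ascent and the lower end of the
    other would create a chain.\<close>
  then have "e = a \<or> d = b"
    using ascent_no_chain assms(1) v(2) by blast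
  then show thesis
    using that v by blast
qed

text \<open>The degree bounds prevent both neighbours from sharing the same end of the ascent, so
  one is found at each end.\<close>

lemma cycle_neighbours:
  assumes cyc: "is_cycle (G12 \<pi>) c" and ab: "ascent a b" "{a, b} \<in> set c"
  obtains d e where "d \<noteq> b" "ascent a d" "{a, d} \<in> set c" "e \<noteq> a" "ascent e b" "{e, b} \<in> set c"
proof -
  obtain v w where vw: "v \<in> set c" "w \<in> set c" "v \<noteq> w" "{a, b} \<noteq> v" "{a, b} \<noteq> w"
    and edges: "{{a, b}, v} \<in> snd (G12 \<pi>)" "{{a, b}, w} \<in> snd (G12 \<pi>)"
    using is_cycle_two_neighbours[OF cyc ab(2)] by blast
  from ab(1) edges(1) show thesis
  proof (cases rule: neighbour_cases)
    case v: (1 d)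
    from ab(1) edges(2) show thesis
    proof (cases rule: neighbour_cases)
      case (1 d')
      \<comment> \<open>Here \<open>b\<close>, \<open>d\<close>, \<open>d'\<close> would be three
        distinct upper ends for \<open>a\<close>.\<close>
      with v vw ab no_three_tops[of a b d d'] show thesis by auto
    next
      case (2 e)
      with v vw show thesis by (intro that[of d e]) auto
    qed
  next
    case v: (2 e)
    from ab(1) edges(2) show thesis
    proof (cases rule: neighbour_cases)
      case (1 d)
      with v vw show thesis by (intro that[of d e]) auto
    next
      case (2 e')
      \<comment> \<open>Here \<open>a\<close>, \<open>e\<close>, \<open>e'\<close> would be three
        distinct lower ends for \<open>b\<close>.\<close>
      with v vw ab no_three_bottoms[of a b e e'] show thesis by auto
    qed
  qed
qed

lemma forest: "is_forest (G12 \<pi>)"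
  unfolding is_forest_def
proof
  assume "\<exists>c. is_cycle (G12 \<pi>) c"
  then obtain c where cyc: "is_cycle (G12 \<pi>) c" ..
  define P where "P a \<longleftrightarrow> (\<exists>b. ascent a b \<and> {a, b} \<in> set c)" for a
  define a where "a = (LEAST a. P a)"
  have "set c \<subseteq> V12 \<pi>" "c \<noteq> []"
    using cyc by (auto simp: is_cycle_def)
  then have "\<exists>a. P a"
    by (metis P_def V12_ascent hd_in_set subsetD)
  then have "P a"
    unfolding a_def by (rule LeastI_ex)
  then obtain b0 where "ascent a b0" "{a, b0} \<in> set c"
    by (auto simp: P_def)
  then obtain d0 where "d0 \<noteq> b0" "ascent a d0" "{a, d0} \<in> set c"
    using cycle_neighbours[OF cyc] by metis
  with \<open>ascent a b0\<close> \<open>{a, b0} \<in> set c\<close> obtain b d where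
    bd: "b < d" "ascent a b" "ascent a d" "{a, b} \<in> set c"
    \<comment> \<open>Both ascents from \<open>a\<close> lie on the cycle, so either upper end may
      serve as the smaller one, \<open>b\<close>.\<close>
    by (metis linorder_neqE_nat)
  then obtain a' where a': "a' \<noteq> a" "ascent a' b" "{a', b} \<in> set c"
    using cycle_neighbours[OF cyc] by metis
  \<comment> \<open>The ascent from \<open>a'\<close> to \<open>b\<close> is on the cycle, so
    minimality of \<open>a\<close> applies to \<open>a'\<close>.\<close>
  then have "a \<le> a'"
    unfolding a_def by (auto simp: P_def intro!: Least_le)
  with a' have "a < a'"
    by simp
  then have "pval \<pi> a' < pval \<pi> a" "pval \<pi> d < pval \<pi> b"
    using a' bd bottoms_decreasing tops_decreasing by blast+
  \<comment> \<open>The positions are ordered \<open>a < a' < b < d\<close>, and the ascent from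
    \<open>a\<close> to \<open>d\<close> supplies the middle inequality of 2143.\<close>
  with bd a' \<open>a < a'\<close> have "contains_pattern \<pi> [2, 1, 4, 3]"
    unfolding contains_2143_iff ascent_def by blast
  with avoids_2143 show False ..
qed

end

theorem theorem5p6:
  shows "G12_forest = Av {[1,2,3], [1,4,3,2], [2,1,4,3], [3,2,1,4]}"
  unfolding G12_forest_def Av_def
  using avoiding_perm.forest[OF avoiding_perm.intro] forest_avoids_123 forest_avoids_1432
    forest_avoids_2143 forest_avoids_3214
  by blast

end
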